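(* Let $g_0:\mathbb{R}^n\to\overline{\mathbb{R}}$ be proper and lsc, let $H_i:\mathbb{R}^n\rightrightarrows\Xi$ be osc and $b_i\in[0,1]$ for $i=1,\dots,m$, let $\mu,\mu^\nu\in\mathscr{P}(\Xi)$, and let $\phi(x)=g_0(x)+\sum_{i=1}^m\iota_{(-\infty,0]}\big(b_i-\mu(H_i(x))\big)$ with $\operatorname{argmin}\phi\ne\emptyset$. Suppose $d_{\rm BL}(\mu^\nu,\mu)\to0$, let $\alpha\ge1$, and let $\lambda^\nu\in(0,\infty)\to0$ and $\theta^\nu\in(0,\infty)\to0$ satisfy $\tfrac1{\lambda^\nu}\big(\tfrac1{\theta^\nu}d_{\rm BL}(\mu^\nu,\mu)\big)^\alpha\to0$. Define, for $(u,x)\in\mathbb{R}^m\times\mathbb{R}^n$, $$f^\nu(u,x)=g_0(x)+\sum_{i=1}^m\iota_{(-\infty,0]}\big(u_i+\mathbb{E}_{\mu^\nu}[g_i^\nu(\boldsymbol\xi,x)]\big)+\tfrac1{\alpha\lambda^\nu}\|u\|_2^\alpha,\qquad g_i^\nu(\xi,x)=b_i+\min\{0,\tfrac1{\theta^\nu}\operatorname{dist}(\xi,H_i(x))-1\}.$$ If the sequence $\{(u^\nu,x^\nu)\}_\nu$ is bounded with $(u^\nu,x^\nu)\in\epsilon^\nu\text{-}\operatorname{argmin}f^\nu$ for all $\nu$, where $\epsilon^\nu\in[0,\infty)\to0$, then: (a) $f^\nu(u^\nu,x^\nu)\to\inf\phi$; (b) $\operatorname{LimOut}(\epsilon^\nu\text{-}\operatorname{argmin}f^\nu)\subseteq\{0\}\times\operatorname{argmin}\phi$;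 in particular, every cluster point of $\{x^\nu\}_\nu$ belongs to $\operatorname{argmin}\phi$.
   Context: $\Xi\subseteq\mathbb{R}^d$ is nonempty and closed; $\mathscr{P}(\Xi)$ is the set of Borel probability measures on $\Xi$; $\overline{\mathbb{R}}=[-\infty,\infty]$; lsc = lower semicontinuous; proper = never $-\infty$ and not identically $\infty$. $\iota_C=0$ on $C$, $\infty$ off $C$. $\operatorname{dist}(\xi,C)=\inf_{\zeta\in C}\|\xi-\zeta\|_2$ ($=\infty$ if $C=\emptyset$). $H:\mathbb{R}^n\rightrightarrows\Xi$ is osc (outer semicontinuous) if $x^\nu\to x$, $\xi^\nu\in H(x^\nu)$ and $\xi$ a cluster point of $\{\xi^\nu\}$ imply $\xi\in H(x)$ (equivalently, closed graph). $d_{\rm BL}(\mu_1,\mu_2)=\sup\big|\int_\Xi\ell\,d(\mu_1-\mu_2)\big|$ over all $\ell:\Xi\to[-1,1]$ that are $1$-Lipschitz w.r.t. $\|\cdot\|_2$. For $\psi:\mathbb{R}^k\to\overline{\mathbb{R}}$: $\operatorname{dom}\psi=\{\psi<\infty\}$, $\operatorname{argmin}\psi=\{z\in\operatorname{dom}\psi:\psi(z)=\inf\psi\}$, $\epsilon\text{-}\operatorname{argmin}\psi=\{z\in\operatorname{dom}\psi:\psi(z)\le\inf\psi+\epsilon\}$. For sets $C^\nu\subseteq\mathbb{R}^k$, $\operatorname{LimOut}C^\nu$ is the set of limits of sequences $z^\nu\in C^\nu$, $\nu\in N$, over infinite $N\subseteq\mathbb{N}$. *)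

theory Defs
  imports "HOL-Probability.Probability"
begin

subsection \<open>Extended-real-valued functions\<close>

definition proper_fun :: "('a \<Rightarrow> ereal) \<Rightarrow> bool" where
  "proper_fun f \<longleftrightarrow> (\<forall>x. f x \<noteq> -\<infinity>) \<and> (\<exists>x. f x \<noteq> \<infinity>)"

definition lsc_fun :: "('a::topological_space \<Rightarrow> ereal) \<Rightarrow> bool" where
  "lsc_fun f \<longleftrightarrow> (\<forall>x. f x \<le> Liminf (at x) f)"

definition iota :: "'a set \<Rightarrow> 'a \<Rightarrow> ereal" where
  "iota C x = (if x \<in> C then 0 else \<infinity>)"

definition eff_dom :: "('a \<Rightarrow> ereal) \<Rightarrow> 'a set" where
  "eff_dom f = {z. f z < \<infinity>}"

definition argmin_set :: "('a \<Rightarrow> ereal) \<Rightarrow> 'a set" where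
  "argmin_set f = {z \<in> eff_dom f. f z = (INF y. f y)}"

definition eps_argmin :: "real \<Rightarrow> ('a \<Rightarrow> ereal) \<Rightarrow> 'a set" where
  "eps_argmin \<epsilon> f = {z \<in> eff_dom f. f z \<le> (INF y. f y) + ereal \<epsilon>}"

subsection \<open>Cluster points, outer limits and outer semicontinuity\<close>

definition cluster_point :: "(nat \<Rightarrow> 'a::topological_space) \<Rightarrow> 'a \<Rightarrow> bool" where
  "cluster_point X a \<longleftrightarrow> (\<exists>r. strict_mono r \<and> (X \<circ> r) \<longlonglongrightarrow> a)"

text \<open>An infinite index set is represented by its strictly increasing enumeration \<open>r\<close>.\<close>

definition LimOut :: "(nat \<Rightarrow> 'a::topological_space set) \<Rightarrow> 'a set" where
  "LimOut C = {z. \<exists>(r::nat \<Rightarrow> nat) zs. strict_mono r \<and> (\<forall>k. zs k \<in> C (r k)) \<and> zs \<longlonglongrightarrow> z}"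

definition osc :: "('a::topological_space \<Rightarrow> 'b::topological_space set) \<Rightarrow> bool" where
  "osc H \<longleftrightarrow> (\<forall>xs x \<xi>s \<xi>. xs \<longlonglongrightarrow> x \<and> (\<forall>\<nu>. \<xi>s \<nu> \<in> H (xs \<nu>)) \<and> cluster_point \<xi>s \<xi> \<longrightarrow> \<xi> \<in> H x)"

subsection \<open>Distance to a set and bounded-Lipschitz distance\<close>

text \<open>In contrast to \<^const>\<open>infdist\<close>, the distance to the empty set is \<open>\<infinity>\<close>.\<close>

definition ext_dist :: "'a::real_normed_vector \<Rightarrow> 'a set \<Rightarrow> ereal" where
  "ext_dist \<xi> C = (INF \<zeta>\<in>C. ereal (norm (\<xi> - \<zeta>)))"

text \<open>The measures in this set have underlying space \<open>\<Xi>\<close>.\<close>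

definition borel_probs :: "'a::topological_space set \<Rightarrow> 'a measure set" where
  "borel_probs \<Xi> = {M. prob_space M \<and> sets M = sets (restrict_space borel \<Xi>)}"

text \<open>For probability measures on \<open>\<Xi>\<close> the supremum is over a nonempty set bounded by \<open>2\<close>.
  Values of \<open>l\<close> outside \<open>\<Xi>\<close> are irrelevant.\<close>

definition d_BL :: "'a::metric_space set \<Rightarrow> 'a measure \<Rightarrow> 'a measure \<Rightarrow> real" where
  "d_BL \<Xi> M1 M2 = (SUP l \<in> {l. l ` \<Xi> \<subseteq> {-1..1} \<and> 1-lipschitz_on \<Xi> l}.
     \<bar>(LINT \<xi>|M1. l \<xi>) - (LINT \<xi>|M2. l \<xi>)\<bar>)"

subsection \<open>Actual and approximating objective functions\<close>

definition phi_obj ::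
  "(real^'n \<Rightarrow> ereal) \<Rightarrow> ('m::finite \<Rightarrow> real^'n \<Rightarrow> (real^'d) set) \<Rightarrow> ('m \<Rightarrow> real)
    \<Rightarrow> (real^'d) measure \<Rightarrow> real^'n \<Rightarrow> ereal" where
  "phi_obj g0 H b M x = g0 x + (\<Sum>i\<in>UNIV. iota {..0} (b i - measure M (H i x)))"

text \<open>For \<open>\<theta> > 0\<close> the minimum lies in \<open>[-1, 0]\<close>, so the conversion to \<^typ>\<open>real\<close> is exact;
  it is \<open>0\<close> if \<open>C\<close> is empty.\<close>

definition g_approx :: "real \<Rightarrow> real \<Rightarrow> 'a::real_normed_vector set \<Rightarrow> 'a \<Rightarrow> real" where
  "g_approx \<beta> \<theta> C \<xi> = \<beta> + real_of_ereal (min 0 (ereal (1 / \<theta>) * ext_dist \<xi> C - 1))"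

definition f_approx ::
  "(real^'n \<Rightarrow> ereal) \<Rightarrow> ('m::finite \<Rightarrow> real^'n \<Rightarrow> (real^'d) set) \<Rightarrow> ('m \<Rightarrow> real)
    \<Rightarrow> real \<Rightarrow> (real^'d) measure \<Rightarrow> real \<Rightarrow> real \<Rightarrow> (real^'m) \<times> (real^'n) \<Rightarrow> ereal" where
  "f_approx g0 H b \<alpha> M \<theta> lam = (\<lambda>(u, x).
     g0 x + (\<Sum>i\<in>UNIV. iota {..0} (u $ i + (LINT \<xi>|M. g_approx (b i) \<theta> (H i x) \<xi>)))
       + ereal (1 / (\<alpha> * lam) * norm u powr \<alpha>))"

end

theory Submission
  imports Defs
begin

text \<open>
  Let \<open>hat \<theta> C = max 0 (1 - dist \<cdot> C / \<theta>)\<close>, so that \<open>g\<^sub>i\<^sup>\<nu> = b\<^sub>i - hat \<theta>\<^sup>\<nu> (H\<^sub>i x)\<close>. This function dominates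
  the indicator of \<open>C\<close> and, for \<open>\<theta> \<le> 1\<close>, \<open>\<theta> hat \<theta> C\<close> is an admissible test function for \<open>d_BL\<close>; hence
  its expectations under \<open>\<mu>\<^sup>\<nu>\<close> and \<open>\<mu>\<close> differ by at most \<open>\<delta>\<^sup>\<nu> = d_BL / \<theta>\<^sup>\<nu>\<close>. For a minimizer \<open>x\<^sup>*\<close>
  of \<open>\<phi>\<close> the point \<open>((-\<delta>\<^sup>\<nu>, \<dots>, -\<delta>\<^sup>\<nu>), x\<^sup>*)\<close> is therefore feasible for \<open>f\<^sup>\<nu>\<close>, and the rate condition makes
  its penalty vanish, so \<open>inf f\<^sup>\<nu>\<close> is at most \<open>inf \<phi> + o(1)\<close>. Conversely, along a convergent sequence of
  near-minimizers the penalty stays bounded, which forces \<open>u \<rightarrow> 0\<close>; outer semicontinuity makes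
  \<open>hat \<theta>\<^sup>\<nu> (H\<^sub>i x\<^sup>\<nu>)\<close> tend to \<open>0\<close> off \<open>H\<^sub>i x\<close>, so by dominated convergence the limit \<open>x\<close> is feasible for
  \<open>\<phi>\<close>, and lower semicontinuity of \<open>g\<^sub>0\<close> gives optimality.
\<close>

subsection \<open>Semicontinuity\<close>

text \<open>\<open>lsc_fun\<close> controls \<open>g\<close> only on punctured neighbourhoods; the
  hypothesis \<open>c < g z\<close> covers indices with \<open>zs k = z\<close>.\<close>

lemma lsc_fun_eventually_less:
  assumes "lsc_fun g" "zs \<longlonglongrightarrow> z" "c < g z"
  shows "\<forall>\<^sub>F k in sequentially. c < g (zs k)"
proof -
  have "c < Liminf (at z) g"
    using assms(1,3) unfolding lsc_fun_def by (meson less_le_trans)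
  then have "\<forall>\<^sub>F y in at z. c < g y"
    by (rule less_LiminfD)
  then have "\<forall>\<^sub>F y in nhds z. c < g y"
    using assms(3) by (auto simp: eventually_at_filter elim!: eventually_mono)
  with assms(2) show ?thesis
    by (rule eventually_compose_filterlim[rotated])
qed

lemma osc_limit:
  assumes "osc H" "xs \<longlonglongrightarrow> x" "\<And>k. \<xi>s k \<in> H (xs k)" "\<xi>s \<longlonglongrightarrow> \<xi>"
  shows "\<xi> \<in> H x"
proof -
  have "cluster_point \<xi>s \<xi>"
    unfolding cluster_point_def using assms(4) by (intro exI[of _ id]) (auto simp: strict_mono_def)
  with assms show ?thesis
    unfolding osc_def by blast
qed

text \<open>Apply \<open>osc_limit\<close> with constant base points. Closedness makes the values of
  \<open>H\<close> measurable.\<close>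

lemma osc_closed:
  fixes H :: "'a::topological_space \<Rightarrow> 'b::first_countable_topology set"
  assumes "osc H"
  shows "closed (H x)"
  unfolding closed_sequential_limits
  using osc_limit[OF assms tendsto_const] by blast

subsection \<open>The hat function\<close>

text \<open>\<open>infdist\<close> to the empty set is 0 and would give the value 1; the case split
  restores the value 0 that the infinite \<open>ext_dist\<close> dictates.\<close>

definition hat :: "real \<Rightarrow> 'a::metric_space set \<Rightarrow> 'a \<Rightarrow> real" where
  "hat \<theta> C \<xi> = (if C = {} then 0 else max 0 (1 - infdist \<xi> C / \<theta>))"

lemma ext_dist_eq_infdist:
  assumes "C \<noteq> {}"
  shows "ext_dist \<xi> C = ereal (infdist \<xi> C)"
proof -
  have bdd: "bdd_below ((\<lambda>\<zeta>. norm (\<xi> - \<zeta>)) ` C)"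
    by (intro bdd_belowI[of _ 0]) auto
  \<comment> \<open>Finiteness is what lets the infimum in \<open>ereal\<close> be computed as a
    real one.\<close>
  have "\<bar>INF \<zeta>\<in>C. ereal (norm (\<xi> - \<zeta>))\<bar> \<noteq> \<infinity>"
  proof -
    obtain a where "a \<in> C"
      using assms by blast
    then have "(INF \<zeta>\<in>C. ereal (norm (\<xi> - \<zeta>))) \<le> ereal (norm (\<xi> - a))"
      by (rule INF_lower)
    moreover have "0 \<le> (INF \<zeta>\<in>C. ereal (norm (\<xi> - \<zeta>)))"
      by (intro INF_greatest) auto
    ultimately show ?thesis
      by auto
  qed
  then show ?thesis
    using assms unfolding ext_dist_def infdist_def by (simp add: ereal_Inf' dist_norm image_image ereal_INF)
qed

lemma g_approx_eq_hat:
  assumes "\<theta> > 0"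
  shows "g_approx \<beta> \<theta> C \<xi> = \<beta> - hat \<theta> C \<xi>"
proof (cases "C = {}")
  case True
  then show ?thesis
    using assms by (simp add: g_approx_def hat_def ext_dist_def top_ereal_def min_def)
next
  case False
  have "min 0 (ereal (1 / \<theta>) * ereal (infdist \<xi> C) - 1) = ereal (min 0 (infdist \<xi> C / \<theta> - 1))"
    by (simp add: one_ereal_def zero_ereal_def min_def)
  with False show ?thesis
    by (auto simp: g_approx_def hat_def ext_dist_eq_infdist min_def max_def)
qed

lemma hat_nonneg: "0 \<le> hat \<theta> C \<xi>"
  by (simp add: hat_def)

lemma hat_le_1: "\<theta> > 0 \<Longrightarrow> hat \<theta> C \<xi> \<le> 1"
  by (simp add: hat_def infdist_nonneg)

lemma hat_eq_1: "\<xi> \<in> C \<Longrightarrow> hat \<theta> C \<xi> = 1"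
  by (auto simp: hat_def)

text \<open>\<open>infdist\<close> is 1-Lipschitz in its point, division by \<open>\<theta>\<close>
  rescales the constant, and truncation at 0 does not increase differences.\<close>

lemma hat_lipschitz:
  assumes "\<theta> > 0"
  shows "(1 / \<theta>)-lipschitz_on X (hat \<theta> C)"
proof (rule lipschitz_onI)
  fix x y
  have "\<bar>infdist x C - infdist y C\<bar> / \<theta> \<le> dist x y / \<theta>"
    using assms by (intro divide_right_mono infdist_triangle_abs) auto
  then have "\<bar>infdist x C / \<theta> - infdist y C / \<theta>\<bar> \<le> dist x y / \<theta>"
    using assms by (simp add: diff_divide_distrib[symmetric])
  then show "dist (hat \<theta> C x) (hat \<theta> C y) \<le> 1 / \<theta> * dist x y"
    by (auto simp: hat_def dist_real_def)
qed (use assms in auto)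

text \<open>The values are even eventually 0. Otherwise, along a subsequence,
  \<open>H (xs k)\<close> has points closer than \<open>\<theta> k\<close> to \<open>\<xi>\<close>;
  they converge to \<open>\<xi>\<close>, and outer semicontinuity puts \<open>\<xi>\<close> into
  \<open>H x\<close>.\<close>

lemma hat_tendsto_0:
  assumes "osc H" "xs \<longlonglongrightarrow> x" "\<xi> \<notin> H x" "\<And>k. \<theta> k > 0" "\<theta> \<longlonglongrightarrow> 0"
  shows "(\<lambda>k. hat (\<theta> k) (H (xs k)) \<xi>) \<longlonglongrightarrow> 0"
proof -
  have "\<forall>\<^sub>F k in sequentially. hat (\<theta> k) (H (xs k)) \<xi> = 0"
  proof (rule ccontr)
    assume "\<not> ?thesis"
    then obtain r :: "nat \<Rightarrow> nat"
      where r: "strict_mono r" "\<And>k. hat (\<theta> (r k)) (H (xs (r k))) \<xi> \<noteq> 0"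
      using not_eventually_sequentiallyD by blast
    have "\<exists>\<zeta>\<in>H (xs (r k)). dist \<xi> \<zeta> < \<theta> (r k)" for k
    proof -
      have "H (xs (r k)) \<noteq> {}" "infdist \<xi> (H (xs (r k))) < \<theta> (r k)"
        using r(2)[of k] assms(4)[of "r k"] by (auto simp: hat_def max_def field_simps split: if_splits)
      then show ?thesis
        by (simp add: infdist_def cINF_less_iff split: if_splits)
    qed
    then obtain \<zeta> where \<zeta>: "\<And>k. \<zeta> k \<in> H (xs (r k))" "\<And>k. dist \<xi> (\<zeta> k) < \<theta> (r k)"
      by metis
    have "(\<lambda>k. dist (\<zeta> k) \<xi>) \<longlonglongrightarrow> 0"
    proof (rule tendsto_sandwich[OF _ _ tendsto_const])
      show "(\<lambda>k. \<theta> (r k)) \<longlonglongrightarrow> 0"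
        using LIMSEQ_subseq_LIMSEQ[OF assms(5) r(1)] by (simp add: comp_def)
    qed (use \<zeta>(2) in \<open>auto simp: dist_commute less_imp_le\<close>)
    then have "\<zeta> \<longlonglongrightarrow> \<xi>"
      by (rule tendsto_dist_iff[THEN iffD2])
    moreover have "(\<lambda>k. xs (r k)) \<longlonglongrightarrow> x"
      using LIMSEQ_subseq_LIMSEQ[OF assms(2) r(1)] by (simp add: comp_def)
    ultimately have "\<xi> \<in> H x"
      using osc_limit[OF assms(1)] \<zeta>(1) by blast
    with assms(3) show False ..
  qed
  then show ?thesis
    by (rule tendsto_eventually)
qed

subsection \<open>Integrals of hat functions\<close>

lemma borel_probsD:
  assumes "M \<in> borel_probs \<Xi>"
  shows "prob_space M" "sets M = sets (restrict_space borel \<Xi>)" "space M = \<Xi>"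
  using assms sets_eq_imp_space_eq[of M "restrict_space borel \<Xi>"]
  by (auto simp: borel_probs_def space_restrict_space)

lemma borel_probs_measurable:
  fixes h :: "'a::metric_space \<Rightarrow> real"
  assumes "M \<in> borel_probs \<Xi>" "L-lipschitz_on \<Xi> h"
  shows "h \<in> borel_measurable M"
proof -
  have "h \<in> borel_measurable (restrict_space borel \<Xi>)"
    using assms(2) by (intro borel_measurable_continuous_on_restrict lipschitz_on_continuous_on)
  then show ?thesis
    using measurable_cong_sets[OF borel_probsD(2)[OF assms(1)] refl] by blast
qed

lemma borel_probs_closed_sets:
  assumes "M \<in> borel_probs \<Xi>" "closed C" "C \<subseteq> \<Xi>"
  shows "C \<in> sets M"
  unfolding borel_probsD(2)[OF assms(1)] sets_restrict_space
  using assms(2,3) by (intro image_eqI[of _ _ C]) (auto simp: borel_closed)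

lemma (in prob_space) integral_abs_le:
  fixes l :: "'a \<Rightarrow> real"
  assumes "\<And>\<xi>. \<xi> \<in> space M \<Longrightarrow> \<bar>l \<xi>\<bar> \<le> B" "0 \<le> B"
  shows "\<bar>integral\<^sup>L M l\<bar> \<le> B"
proof (cases "integrable M l")
  case True
  have "\<bar>integral\<^sup>L M l\<bar> \<le> (LINT \<xi>|M. \<bar>l \<xi>\<bar>)"
    by (rule integral_abs_bound)
  also have "\<dots> \<le> B"
    using True assms(1) by (intro integral_le_const) auto
  finally show ?thesis .
\<comment> \<open>A non-integrable function has integral 0 by convention.\<close>
qed (use assms(2) in \<open>simp add: not_integrable_integral_eq\<close>)

text \<open>A real supremum bounds its members only if they are bounded above; here 2 works, as each
  integral is at most 1 in absolute value.\<close>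

lemma abs_diff_integral_le_d_BL:
  assumes "M1 \<in> borel_probs \<Xi>" "M2 \<in> borel_probs \<Xi>" "l ` \<Xi> \<subseteq> {-1..1}" "1-lipschitz_on \<Xi> l"
  shows "\<bar>(LINT \<xi>|M1. l \<xi>) - (LINT \<xi>|M2. l \<xi>)\<bar> \<le> d_BL \<Xi> M1 M2"
proof -
  have le_1: "\<bar>LINT \<xi>|M. h \<xi>\<bar> \<le> 1" if "M \<in> borel_probs \<Xi>" "h ` \<Xi> \<subseteq> {-1..1}" for M and h :: "'a \<Rightarrow> real"
    using that borel_probsD[OF that(1)]
    by (intro prob_space.integral_abs_le) (auto simp: image_subset_iff abs_le_iff minus_le_iff)
  show ?thesis
    unfolding d_BL_def
  proof (rule cSUP_upper)
    show "bdd_above ((\<lambda>l. \<bar>(LINT \<xi>|M1. l \<xi>) - (LINT \<xi>|M2. l \<xi>)\<bar>)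
        ` {l. l ` \<Xi> \<subseteq> {-1..1::real} \<and> 1-lipschitz_on \<Xi> l})"
    proof (rule bdd_aboveI2)
      fix h assume "h \<in> {l. l ` \<Xi> \<subseteq> {-1..1::real} \<and> 1-lipschitz_on \<Xi> l}"
      then show "\<bar>(LINT \<xi>|M1. h \<xi>) - (LINT \<xi>|M2. h \<xi>)\<bar> \<le> 2"
        using le_1[OF assms(1), of h] le_1[OF assms(2), of h] by auto
    qed
  qed (use assms in auto)
qed

lemma d_BL_nonneg:
  assumes "M1 \<in> borel_probs \<Xi>" "M2 \<in> borel_probs \<Xi>"
  shows "0 \<le> d_BL \<Xi> M1 M2"
  using abs_diff_integral_le_d_BL[OF assms, of "\<lambda>_. 0"] by (simp add: image_subset_iff lipschitz_on_def)

context
  fixes M :: "'a::metric_space measure" and \<Xi> :: "'a set" and \<theta> :: real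
  assumes M: "M \<in> borel_probs \<Xi>" and \<theta>: "\<theta> > 0"
begin

interpretation prob_space M
  by (rule borel_probsD(1)[OF M])

lemma hat_measurable: "hat \<theta> C \<in> borel_measurable M"
  using borel_probs_measurable[OF M hat_lipschitz[OF \<theta>]] .

lemma hat_integrable: "integrable M (hat \<theta> C)"
  by (rule integrable_const_bound[of _ 1]) (simp_all add: hat_measurable hat_nonneg hat_le_1 \<theta>)

lemma measure_le_integral_hat:
  assumes "closed C" "C \<subseteq> \<Xi>"
  shows "measure M C \<le> integral\<^sup>L M (hat \<theta> C)"
proof -
  have "C \<in> sets M"
    using borel_probs_closed_sets[OF M assms] .
  then have "measure M C = (LINT \<xi>|M. indicator C \<xi>)"
    by simp
  also have "\<dots> \<le> integral\<^sup>L M (hat \<theta> C)"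
    using \<open>C \<in> sets M\<close>
    by (intro integral_mono hat_integrable) (auto simp: hat_eq_1 hat_nonneg emeasure_eq_measure split: split_indicator)
  finally show ?thesis .
qed

text \<open>The factor \<open>\<theta>\<close> cancels the Lipschitz constant
  \<open>1 / \<theta>\<close>, and \<open>\<theta> \<le> 1\<close> keeps the scaled hat within
  [0, 1]; dividing by \<open>\<theta>\<close> afterwards gives the bound.\<close>

lemma integral_hat_diff_le:
  assumes "N \<in> borel_probs \<Xi>" "\<theta> \<le> 1"
  shows "\<bar>integral\<^sup>L N (hat \<theta> C) - integral\<^sup>L M (hat \<theta> C)\<bar> \<le> d_BL \<Xi> N M / \<theta>"
proof -
  have "\<bar>(LINT \<xi>|N. \<theta> * hat \<theta> C \<xi>) - (LINT \<xi>|M. \<theta> * hat \<theta> C \<xi>)\<bar> \<le> d_BL \<Xi> N M"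
  proof (rule abs_diff_integral_le_d_BL[OF assms(1) M])
    have "0 \<le> \<theta> * hat \<theta> C \<xi>" "\<theta> * hat \<theta> C \<xi> \<le> 1" for \<xi>
      using \<theta> assms(2) mult_le_one[OF assms(2) hat_nonneg hat_le_1[OF \<theta>]] by (simp_all add: hat_nonneg)
    then show "(\<lambda>\<xi>. \<theta> * hat \<theta> C \<xi>) ` \<Xi> \<subseteq> {-1..1}"
      by (simp add: image_subset_iff) (meson order_trans neg_le_0_iff_le zero_le_one)
    show "1-lipschitz_on \<Xi> (\<lambda>\<xi>. \<theta> * hat \<theta> C \<xi>)"
      using lipschitz_on_cmult_real[OF hat_lipschitz[OF \<theta>], of \<theta> \<Xi> C] \<theta> by simp
  qed
  then have "\<theta> * \<bar>integral\<^sup>L N (hat \<theta> C) - integral\<^sup>L M (hat \<theta> C)\<bar> \<le> d_BL \<Xi> N M"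
    using \<theta> by (simp add: right_diff_distrib[symmetric] abs_mult)
  then show ?thesis
    using \<theta> by (simp add: field_simps)
qed

end

lemma integral_g_approx:
  assumes "M \<in> borel_probs \<Xi>" "\<theta> > 0"
  shows "(LINT \<xi>|M. g_approx \<beta> \<theta> C \<xi>) = \<beta> - integral\<^sup>L M (hat \<theta> C)"
proof -
  interpret prob_space M
    by (rule borel_probsD(1)[OF assms(1)])
  show ?thesis
    by (simp add: g_approx_eq_hat assms(2) hat_integrable[OF assms] prob_space)
qed

text \<open>Passes from relaxed constraints along the sequence to the probability constraint at its
  limit.\<close>

lemma integral_hat_limit:
  assumes M: "M \<in> borel_probs \<Xi>" and H: "osc H" "\<And>y. H y \<subseteq> \<Xi>"
    and xs: "xs \<longlonglongrightarrow> x" and \<theta>: "\<And>k. \<theta> k > 0" "\<theta> \<longlonglongrightarrow> 0"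
    and le: "\<And>k. c k \<le> integral\<^sup>L M (hat (\<theta> k) (H (xs k)))" "c \<longlonglongrightarrow> c'"
  shows "c' \<le> measure M (H x)"
proof -
  interpret prob_space M
    by (rule borel_probsD(1)[OF M])
  have Hx [measurable]: "H x \<in> sets M"
    using borel_probs_closed_sets[OF M osc_closed[OF H(1)] H(2)] .
  have [measurable]: "hat (\<theta> k) (H (xs k)) \<in> borel_measurable M" for k
    using hat_measurable[OF M \<theta>(1)] .
  \<comment> \<open>On \<open>H x\<close> the hats may fail to converge. The maximum with the
    indicator is constantly 1 there, so \<open>?h\<close> converges everywhere, and it still
    dominates the hats.\<close>
  let ?h = "\<lambda>k \<xi>. max (indicator (H x) \<xi>) (hat (\<theta> k) (H (xs k)) \<xi>)"
  have bound: "norm (?h k \<xi>) \<le> 1" for k \<xi>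
    using hat_nonneg[of "\<theta> k" "H (xs k)" \<xi>] hat_le_1[OF \<theta>(1), of k "H (xs k)" \<xi>]
    by (auto split: split_indicator)
  have "(\<lambda>k. integral\<^sup>L M (?h k)) \<longlonglongrightarrow> (LINT \<xi>|M. indicator (H x) \<xi>)"
  proof (rule integral_dominated_convergence[where w = "\<lambda>_. 1"])
    show "AE \<xi> in M. (\<lambda>k. ?h k \<xi>) \<longlonglongrightarrow> indicator (H x) \<xi>"
    proof (rule AE_I2)
      fix \<xi>
      show "(\<lambda>k. ?h k \<xi>) \<longlonglongrightarrow> indicator (H x) \<xi>"
      proof (cases "\<xi> \<in> H x")
        case True
        then show ?thesis
          by (simp add: max_absorb1 hat_le_1[OF \<theta>(1)])
      next
        case False
        with hat_tendsto_0[OF H(1) xs False \<theta>] show ?thesis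
          by (simp add: max_absorb2 hat_nonneg)
      qed
    qed
  qed (use bound in auto)
  then have lim: "(\<lambda>k. integral\<^sup>L M (?h k)) \<longlonglongrightarrow> measure M (H x)"
    by simp
  have "c k \<le> integral\<^sup>L M (?h k)" for k
  proof -
    have "integrable M (?h k)"
      by (rule integrable_const_bound[of _ 1]) (use bound in auto)
    then have "integral\<^sup>L M (hat (\<theta> k) (H (xs k))) \<le> integral\<^sup>L M (?h k)"
      by (intro integral_mono hat_integrable[OF M \<theta>(1)]) auto
    with le(1)[of k] show ?thesis
      by linarith
  qed
  with le(2) lim show ?thesis
    by (meson LIMSEQ_le)
qed

subsection \<open>The objective functions\<close>

lemma sum_iota_atMost_0:
  assumes "finite I"
  shows "(\<Sum>i\<in>I. iota {..0} (c i)) = (if \<forall>i\<in>I. c i \<le> (0::real) then 0 else \<infinity>)"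
  using assms by (induction I) (auto simp: iota_def)

lemma phi_obj_eq:
  assumes "g0 x \<noteq> -\<infinity>"
  shows "phi_obj g0 H b M x = (if \<forall>i. b i \<le> measure M (H i x) then g0 x else \<infinity>)"
  using assms by (cases "g0 x") (auto simp: phi_obj_def sum_iota_atMost_0)

text \<open>Since \<open>g_approx\<close> is \<open>b i\<close> minus a hat, its constraint is that
  of \<open>phi_obj_eq\<close> with the probability replaced by an expected hat and the threshold
  shifted by \<open>u\<close>.\<close>

lemma f_approx_eq:
  assumes "g0 x \<noteq> -\<infinity>" "M \<in> borel_probs \<Xi>" "\<theta> > 0"
  shows "f_approx g0 H b \<alpha> M \<theta> lam (u, x) =
    (if \<forall>i. u $ i + b i \<le> integral\<^sup>L M (hat \<theta> (H i x))
     then g0 x + ereal (1 / (\<alpha> * lam) * norm u powr \<alpha>) else \<infinity>)"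
  using assms(1)
  by (cases "g0 x") (auto simp: f_approx_def sum_iota_atMost_0 integral_g_approx[OF assms(2,3)] algebra_simps)

subsection \<open>Convergence of near-minimizers\<close>

theorem corollary4p3:
  fixes \<Xi> :: "(real^'d) set"
    and g0 :: "real^'n \<Rightarrow> ereal"
    and H :: "'m::finite \<Rightarrow> real^'n \<Rightarrow> (real^'d) set"
    and b :: "'m \<Rightarrow> real"
    and \<mu> :: "(real^'d) measure"
    and \<mu>s :: "nat \<Rightarrow> (real^'d) measure"
    and \<alpha> :: real
    and lam \<theta> \<epsilon> :: "nat \<Rightarrow> real"
    and \<phi> :: "real^'n \<Rightarrow> ereal"
    and f :: "nat \<Rightarrow> (real^'m) \<times> (real^'n) \<Rightarrow> ereal"
    and u :: "nat \<Rightarrow> real^'m"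
    and x :: "nat \<Rightarrow> real^'n"
  assumes Xi: "\<Xi> \<noteq> {}" "closed \<Xi>"
    and g0: "proper_fun g0" "lsc_fun g0"
    and H: "\<And>i y. H i y \<subseteq> \<Xi>" "\<And>i. osc (H i)"
    and b: "\<And>i. b i \<in> {0..1}"
    and mu: "\<mu> \<in> borel_probs \<Xi>" "\<And>\<nu>. \<mu>s \<nu> \<in> borel_probs \<Xi>"
    and phi: "\<phi> = phi_obj g0 H b \<mu>"
    and argmin: "argmin_set \<phi> \<noteq> {}"
    and conv: "(\<lambda>\<nu>. d_BL \<Xi> (\<mu>s \<nu>) \<mu>) \<longlonglongrightarrow> 0"
    and alpha: "\<alpha> \<ge> 1"
    and lambda: "\<And>\<nu>. lam \<nu> > 0" "lam \<longlonglongrightarrow> 0"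
    and theta: "\<And>\<nu>. \<theta> \<nu> > 0" "\<theta> \<longlonglongrightarrow> 0"
    and rate: "(\<lambda>\<nu>. 1 / lam \<nu> * (1 / \<theta> \<nu> * d_BL \<Xi> (\<mu>s \<nu>) \<mu>) powr \<alpha>) \<longlonglongrightarrow> 0"
    and f: "\<And>\<nu>. f \<nu> = f_approx g0 H b \<alpha> (\<mu>s \<nu>) (\<theta> \<nu>) (lam \<nu>)"
    and epsilon: "\<And>\<nu>. \<epsilon> \<nu> \<ge> 0" "\<epsilon> \<longlonglongrightarrow> 0"
    and bdd: "bounded (range (\<lambda>\<nu>. (u \<nu>, x \<nu>)))"
    and near: "\<And>\<nu>. (u \<nu>, x \<nu>) \<in> eps_argmin (\<epsilon> \<nu>) (f \<nu>)"
  shows "(\<lambda>\<nu>. f \<nu> (u \<nu>, x \<nu>)) \<longlonglongrightarrow> (INF y. \<phi> y)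
    \<and> LimOut (\<lambda>\<nu>. eps_argmin (\<epsilon> \<nu>) (f \<nu>)) \<subseteq> {0} \<times> argmin_set \<phi>
    \<and> (\<forall>z. cluster_point x z \<longrightarrow> z \<in> argmin_set \<phi>)"
proof -
  have g0_fin: "g0 y \<noteq> -\<infinity>" for y
    using g0(1) by (auto simp: proper_fun_def)
  note \<phi>_eq = phi_obj_eq[of g0 _ H b \<mu>, OF g0_fin, folded phi]
  have f_eq: "f \<nu> (v, y) = (if \<forall>i. v $ i + b i \<le> integral\<^sup>L (\<mu>s \<nu>) (hat (\<theta> \<nu>) (H i y))
      then g0 y + ereal (1 / (\<alpha> * lam \<nu>) * norm v powr \<alpha>) else \<infinity>)" for \<nu> v y
    unfolding f by (rule f_approx_eq[OF g0_fin mu(2) theta(1)])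
  obtain x0 where x0: "\<phi> x0 < \<infinity>" "\<phi> x0 = (INF y. \<phi> y)"
    using argmin by (auto simp: argmin_set_def eff_dom_def)
  then have feas: "b i \<le> measure \<mu> (H i x0)" and "\<phi> x0 = g0 x0" for i
    by (auto simp: \<phi>_eq split: if_splits)
  then obtain V where V: "g0 x0 = ereal V" "(INF y. \<phi> y) = ereal V"
    using x0 g0_fin[of x0] by (cases "g0 x0") auto

  \<comment> \<open>Comparison points and vanishing errors\<close>
  define \<delta> where "\<delta> \<nu> = d_BL \<Xi> (\<mu>s \<nu>) \<mu> / \<theta> \<nu>" for \<nu>
  \<comment> \<open>Here \<open>1\<close> is the all-ones vector: each constraint is relaxed by
    exactly the error bound \<open>\<delta> \<nu>\<close>.\<close>
  define u0 :: "nat \<Rightarrow> real^'m" where "u0 \<nu> = (- \<delta> \<nu>) *\<^sub>R 1" for \<nu>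
  define \<eta> where "\<eta> \<nu> = \<epsilon> \<nu> + 1 / (\<alpha> * lam \<nu>) * norm (u0 \<nu>) powr \<alpha>" for \<nu>
  have \<delta>_nonneg: "0 \<le> \<delta> \<nu>" for \<nu>
    using d_BL_nonneg[OF mu(2,1)] theta(1)[of \<nu>] by (simp add: \<delta>_def)
  have rate': "(\<lambda>\<nu>. 1 / lam \<nu> * \<delta> \<nu> powr \<alpha>) \<longlonglongrightarrow> 0"
    using rate by (simp add: \<delta>_def)
  \<comment> \<open>Multiplying the rate by \<open>lam \<nu>\<close> removes the quotient; the root
    of order \<open>\<alpha>\<close> then gives \<open>\<delta>\<close> itself.\<close>
  have "(\<lambda>\<nu>. \<delta> \<nu> powr \<alpha>) \<longlonglongrightarrow> 0"
    using tendsto_mult[OF lambda(2) rate'] lambda(1) by (simp add: less_imp_neq[symmetric])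
  then have "(\<lambda>\<nu>. (\<delta> \<nu> powr \<alpha>) powr (1 / \<alpha>)) \<longlonglongrightarrow> 0 powr (1 / \<alpha>)"
    using alpha by (intro tendsto_powr') auto
  then have \<delta>_lim: "\<delta> \<longlonglongrightarrow> 0"
    using alpha \<delta>_nonneg by (simp add: powr_powr)
  have penalty: "1 / (\<alpha> * lam \<nu>) * norm (u0 \<nu>) powr \<alpha> = norm (1 :: real^'m) powr \<alpha> / \<alpha> * (1 / lam \<nu> * \<delta> \<nu> powr \<alpha>)" for \<nu>
    using \<delta>_nonneg[of \<nu>] by (simp add: u0_def powr_mult)
  have \<eta>_lim: "\<eta> \<longlonglongrightarrow> 0"
    unfolding \<eta>_def penalty using tendsto_add[OF epsilon(2) tendsto_mult_left[OF rate', of "norm (1 :: real^'m) powr \<alpha> / \<alpha>"]]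
    by simp
  have hat_diff: "\<bar>integral\<^sup>L (\<mu>s \<nu>) (hat (\<theta> \<nu>) C) - integral\<^sup>L \<mu> (hat (\<theta> \<nu>) C)\<bar> \<le> \<delta> \<nu>"
    if "\<theta> \<nu> \<le> 1" for \<nu> C
    unfolding \<delta>_def by (rule integral_hat_diff_le[OF mu(1) theta(1) mu(2) that])
  have \<theta>_le_1: "\<forall>\<^sub>F \<nu> in sequentially. \<theta> \<nu> \<le> 1"
    using order_tendstoD(2)[OF theta(2), of 1] by (auto elim: eventually_mono)

  \<comment> \<open>Upper bound on near-minimal values\<close>
  have upper: "f \<nu> z \<le> ereal (V + \<eta> \<nu>)"
    if "\<theta> \<nu> \<le> 1" "z \<in> eps_argmin (\<epsilon> \<nu>) (f \<nu>)" for \<nu> z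
  proof -
    \<comment> \<open>Feasibility of \<open>x0\<close> bounds \<open>b i\<close> by the expected hat
      under \<open>\<mu>\<close>; changing to \<open>\<mu>s \<nu>\<close> costs at most
      \<open>\<delta> \<nu>\<close>, which \<open>u0\<close> compensates.\<close>
    have "u0 \<nu> $ i + b i \<le> integral\<^sup>L (\<mu>s \<nu>) (hat (\<theta> \<nu>) (H i x0))" for i
      using hat_diff[OF that(1), of "H i x0"] feas[of i]
        measure_le_integral_hat[OF mu(1) theta(1)[of \<nu>] osc_closed[OF H(2)] H(1), of i x0]
      by (simp add: u0_def abs_le_iff)
    then have "f \<nu> (u0 \<nu>, x0) = ereal (V + (\<eta> \<nu> - \<epsilon> \<nu>))"
      by (simp add: f_eq V(1) \<eta>_def)
    then have "(INF z. f \<nu> z) \<le> ereal (V + (\<eta> \<nu> - \<epsilon> \<nu>))"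
      by (metis INF_lower UNIV_I)
    then have "(INF z. f \<nu> z) + ereal (\<epsilon> \<nu>) \<le> ereal (V + (\<eta> \<nu> - \<epsilon> \<nu>)) + ereal (\<epsilon> \<nu>)"
      by (rule add_right_mono)
    with that(2) show ?thesis
      by (auto simp: eps_argmin_def)
  qed

  \<comment> \<open>Limits of convergent near-minimizers\<close>
  have core: "ulim = 0 \<and> xlim \<in> argmin_set \<phi> \<and> (\<lambda>k. f (r k) (us k, xs k)) \<longlonglongrightarrow> ereal V"
    if r: "strict_mono r" and us: "us \<longlonglongrightarrow> ulim" and xs: "xs \<longlonglongrightarrow> xlim"
      and mem: "\<And>k. (us k, xs k) \<in> eps_argmin (\<epsilon> (r k)) (f (r k))"
    for r us xs ulim xlim
  proof -
    have sub: "(\<lambda>k. h (r k)) \<longlonglongrightarrow> 0" if "h \<longlonglongrightarrow> 0" for h :: "nat \<Rightarrow> real"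
      using LIMSEQ_subseq_LIMSEQ[OF that r] by (simp add: comp_def)
    have \<theta>_le: "\<forall>\<^sub>F k in sequentially. \<theta> (r k) \<le> 1"
      using eventually_subseq[OF r \<theta>_le_1] .
    then have f_le: "\<forall>\<^sub>F k in sequentially. f (r k) (us k, xs k) \<le> ereal (V + \<eta> (r k))"
      by (rule eventually_mono) (use upper mem in blast)
    have f_xs: "f (r k) (us k, xs k) = g0 (xs k) + ereal (1 / (\<alpha> * lam (r k)) * norm (us k) powr \<alpha>)"
      and con: "us k $ i + b i \<le> integral\<^sup>L (\<mu>s (r k)) (hat (\<theta> (r k)) (H i (xs k)))" for k i
      using mem[of k] by (auto simp: eps_argmin_def eff_dom_def f_eq split: if_splits)
    have g0_le_f: "g0 (xs k) \<le> f (r k) (us k, xs k)" for k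
      unfolding f_xs using alpha lambda(1)[of "r k"] g0_fin[of "xs k"]
      by (intro ereal_le_add_self) auto
    have g0_gt: "\<forall>\<^sub>F k in sequentially. c < g0 (xs k)" if "c < g0 xlim" for c
      using lsc_fun_eventually_less[OF g0(2) xs that] .

    \<comment> \<open>By lower semicontinuity \<open>g0 (xs k)\<close> eventually exceeds the real
      \<open>c\<close>, so the penalty is at most \<open>V + \<eta> (r k) - c\<close>.
      Multiplication by \<open>\<alpha> * lam (r k)\<close> sends this bound to 0.\<close>
    obtain c where c: "ereal c < g0 xlim"
      using g0_fin[of xlim] ereal_dense2[of "-\<infinity>" "g0 xlim"] by auto
    have "norm ulim powr \<alpha> \<le> 0"
    proof (rule tendsto_le[OF sequentially_bot])
      show "(\<lambda>k. \<alpha> * lam (r k) * (V + \<eta> (r k) - c)) \<longlonglongrightarrow> 0"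
        by (rule tendsto_eq_intros sub[OF lambda(2)] sub[OF \<eta>_lim] refl)+ simp
      show "(\<lambda>k. norm (us k) powr \<alpha>) \<longlonglongrightarrow> norm ulim powr \<alpha>"
        using alpha by (intro tendsto_powr' tendsto_norm us tendsto_const) auto
      show "\<forall>\<^sub>F k in sequentially. norm (us k) powr \<alpha> \<le> \<alpha> * lam (r k) * (V + \<eta> (r k) - c)"
        using f_le g0_gt[OF c]
      proof eventually_elim
        case (elim k)
        obtain w where w: "g0 (xs k) = ereal w"
          using elim f_xs[of k] by (cases "g0 (xs k)") auto
        have "1 / (\<alpha> * lam (r k)) * norm (us k) powr \<alpha> \<le> V + \<eta> (r k) - c"
          using elim by (simp add: f_xs w)
        then show ?case
          using alpha lambda(1)[of "r k"] by (simp add: field_simps)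
      qed
    qed
    then have ulim: "ulim = 0"
      using powr_gt_zero[of "norm ulim" \<alpha>] by (auto simp: not_le[symmetric] simp del: powr_gt_zero)

    have "b i \<le> measure \<mu> (H i xlim)" for i
    proof -
      \<comment> \<open>\<open>integral_hat_limit\<close> asks for its inequality at every index,
        but \<open>hat_diff\<close> assumes \<open>\<theta> \<le> 1\<close>; hence the shift by
        \<open>N\<close>.\<close>
      obtain N where N: "\<And>k. N \<le> k \<Longrightarrow> \<theta> (r k) \<le> 1"
        using \<theta>_le by (auto simp: eventually_sequentially)
      show ?thesis
      proof (rule integral_hat_limit[OF mu(1) H(2) H(1)])
        show "(\<lambda>k. xs (k + N)) \<longlonglongrightarrow> xlim"
          using xs by (rule LIMSEQ_ignore_initial_segment)
        show "(\<lambda>k. \<theta> (r (k + N))) \<longlonglongrightarrow> 0"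
          using sub[OF theta(2)] by (rule LIMSEQ_ignore_initial_segment)
        show "us (k + N) $ i + b i - \<delta> (r (k + N)) \<le> integral\<^sup>L \<mu> (hat (\<theta> (r (k + N))) (H i (xs (k + N))))" for k
          using con[of "k + N" i] hat_diff[OF N, of "k + N" "H i (xs (k + N))"] by simp
        have "(\<lambda>k. us k $ i + b i - \<delta> (r k)) \<longlonglongrightarrow> ulim $ i + b i - 0"
          by (intro tendsto_intros us sub[OF \<delta>_lim])
        then show "(\<lambda>k. us (k + N) $ i + b i - \<delta> (r (k + N))) \<longlonglongrightarrow> b i"
          unfolding ulim by (intro LIMSEQ_ignore_initial_segment) simp
      qed (rule theta(1))
    qed
    then have \<phi>_xlim: "\<phi> xlim = g0 xlim"
      by (simp add: \<phi>_eq)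

    have V\<eta>_lim: "(\<lambda>k. ereal (V + \<eta> (r k))) \<longlonglongrightarrow> ereal V"
      using tendsto_add[OF tendsto_const[of V] sub[OF \<eta>_lim]] by simp
    \<comment> \<open>Lower semicontinuity against the upper bound. With the feasibility of
      \<open>xlim\<close> and the minimality of \<open>V\<close>, this forces equality.\<close>
    have "g0 xlim \<le> ereal V"
    proof (rule dense_le)
      fix a assume "a < g0 xlim"
      from g0_gt[OF this] f_le have "\<forall>\<^sub>F k in sequentially. a \<le> ereal (V + \<eta> (r k))"
        by eventually_elim (meson g0_le_f less_imp_le order_trans)
      with V\<eta>_lim show "a \<le> ereal V"
        by (intro tendsto_lowerbound) auto
    qed
    moreover have "ereal V \<le> \<phi> xlim"
      unfolding V(2)[symmetric] by (rule INF_lower) simp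
    ultimately have g0_xlim: "g0 xlim = ereal V"
      using \<phi>_xlim by simp
    \<comment> \<open>Squeezed between \<open>g0 (xs k)\<close>, eventually above any
      \<open>a < V\<close>, and \<open>V + \<eta> (r k)\<close>.\<close>
    have "(\<lambda>k. f (r k) (us k, xs k)) \<longlonglongrightarrow> ereal V"
    proof (rule order_tendstoI)
      fix a assume "a < ereal V"
      then show "\<forall>\<^sub>F k in sequentially. a < f (r k) (us k, xs k)"
        using g0_gt[of a] g0_le_f by (auto simp: g0_xlim intro: less_le_trans elim!: eventually_mono)
    next
      fix a assume "ereal V < a"
      from f_le order_tendstoD(2)[OF V\<eta>_lim this]
      show "\<forall>\<^sub>F k in sequentially. f (r k) (us k, xs k) < a"
        by eventually_elim (rule le_less_trans)
    qed
    then show ?thesis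
      using ulim \<phi>_xlim g0_xlim V(2) by (simp add: argmin_set_def eff_dom_def)
  qed

  \<comment> \<open>Subsequences and the three conclusions\<close>
  have bdd_conv: "\<exists>s ulim xlim. strict_mono s \<and> (\<lambda>k. u (r (s k))) \<longlonglongrightarrow> ulim \<and> (\<lambda>k. x (r (s k))) \<longlonglongrightarrow> xlim"
    for r :: "nat \<Rightarrow> nat"
  proof -
    have "bounded (range (\<lambda>k. (u (r k), x (r k))))"
      using bdd by (rule bounded_subset) auto
    then obtain l s where "strict_mono s" "((\<lambda>k. (u (r k), x (r k))) \<circ> s) \<longlonglongrightarrow> l"
      using bounded_imp_convergent_subsequence by blast
    then show ?thesis
      using tendsto_fst[of "\<lambda>k. (u (r (s k)), x (r (s k)))" l] tendsto_snd[of "\<lambda>k. (u (r (s k)), x (r (s k)))" l]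
      by (auto simp: comp_def)
  qed

  have "(\<lambda>\<nu>. f \<nu> (u \<nu>, x \<nu>)) \<longlonglongrightarrow> ereal V"
  \<comment> \<open>Subsequence principle: values staying outside a neighbourhood of
    \<open>V\<close> along \<open>r\<close> contradict \<open>core\<close> on a convergent further
    subsequence.\<close>
  proof (rule ccontr)
    assume "\<not> ?thesis"
    then obtain S where S: "open S" "ereal V \<in> S" "\<not> (\<forall>\<^sub>F \<nu> in sequentially. f \<nu> (u \<nu>, x \<nu>) \<in> S)"
      unfolding tendsto_def by blast
    then obtain r :: "nat \<Rightarrow> nat" where r: "strict_mono r" "\<And>k. f (r k) (u (r k), x (r k)) \<notin> S"
      using not_eventually_sequentiallyD[OF S(3)] by blast
    obtain s ulim xlim where s: "strict_mono s" "(\<lambda>k. u (r (s k))) \<longlonglongrightarrow> ulim" "(\<lambda>k. x (r (s k))) \<longlonglongrightarrow> xlim"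
      using bdd_conv by blast
    have "(\<lambda>k. f (r (s k)) (u (r (s k)), x (r (s k)))) \<longlonglongrightarrow> ereal V"
      using core[OF strict_mono_o[OF r(1) s(1)], of "\<lambda>k. u (r (s k))" _ "\<lambda>k. x (r (s k))"] s(2,3) near
      by simp
    then have "\<forall>\<^sub>F k in sequentially. f (r (s k)) (u (r (s k)), x (r (s k))) \<in> S"
      using S(1,2) by (rule topological_tendstoD)
    with r(2) show False
      by simp
  qed
  moreover have "LimOut (\<lambda>\<nu>. eps_argmin (\<epsilon> \<nu>) (f \<nu>)) \<subseteq> {0} \<times> argmin_set \<phi>"
  proof
    fix z assume "z \<in> LimOut (\<lambda>\<nu>. eps_argmin (\<epsilon> \<nu>) (f \<nu>))"
    then obtain r zs where "strict_mono r" "\<And>k. zs k \<in> eps_argmin (\<epsilon> (r k)) (f (r k))" "zs \<longlonglongrightarrow> z"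
      unfolding LimOut_def by blast
    then have "fst z = 0 \<and> snd z \<in> argmin_set \<phi>"
      using core[of r "\<lambda>k. fst (zs k)" "fst z" "\<lambda>k. snd (zs k)" "snd z"] by (simp add: tendsto_fst tendsto_snd)
    then show "z \<in> {0} \<times> argmin_set \<phi>"
      by (cases z) simp
  qed
  moreover have "z \<in> argmin_set \<phi>" if z: "cluster_point x z" for z
  proof -
    obtain r :: "nat \<Rightarrow> nat" where r: "strict_mono r" "(\<lambda>k. x (r k)) \<longlonglongrightarrow> z"
      using z by (auto simp: cluster_point_def comp_def)
    \<comment> \<open>Only \<open>x\<close> is known to converge along \<open>r\<close>; a further
      subsequence makes \<open>u\<close> converge too, as \<open>core\<close> requires.\<close>
    obtain s ulim xlim where s: "strict_mono s" "(\<lambda>k. u (r (s k))) \<longlonglongrightarrow> ulim" "(\<lambda>k. x (r (s k))) \<longlonglongrightarrow> xlim"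
      using bdd_conv by blast
    have "(\<lambda>k. x (r (s k))) \<longlonglongrightarrow> z"
      using LIMSEQ_subseq_LIMSEQ[OF r(2) s(1)] by (simp add: comp_def)
    then show ?thesis
      using core[OF strict_mono_o[OF r(1) s(1)], of "\<lambda>k. u (r (s k))" _ "\<lambda>k. x (r (s k))" z] s(2) near
      by simp
  qed
  ultimately show ?thesis
    unfolding V(2) by blast
qed

end
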